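(* For every nonempty finite subset $P \subseteq \mathbb{R}^2$, $\operatorname{opx}(n, P) = \Theta(\operatorname{ex}(n, M_P))$ (as $n \to \infty$ over positive integers), where the implied constants depend only on the distances between the rows and columns in $P$.
   Context: Containment for subsets of the plane: for $P, S \subseteq \mathbb{R}^2$, let $X_P, Y_P$ be the sets of $x$-coordinates and $y$-coordinates of points of $P$, and $X_S, Y_S$ likewise for $S$. $S$ contains $P$ if there exist functions $f_X: X_P \to X_S$ and $f_Y: Y_P \to Y_S$ such that (1) $\frac{f_X(x_0)-f_X(x_1)}{x_0-x_1} \ge 1$ for all $x_0 > x_1$ in $X_P$; (2) $\frac{f_Y(y_0)-f_Y(y_1)}{y_0-y_1} \ge 1$ for all $y_0 > y_1$ in $Y_P$; (3) $(f_X(x), f_Y(y)) \in S$ for all $(x,y) \in P$. Otherwise $S$ is $P$-free. For real $n > 0$, $\operatorname{opx}(n,P)$ is the supremum of the Lebesgue measure $\mu_2(S)$ over all open (in $\mathbb{R}^2$) $P$-free subsets $S \subseteq [0,n]^2$. A 0-1 matrix $A$ contains a 0-1 matrix $B$ if some submatrix of $A$ (obtained by selecting rows and columns, keeping their order) can be turned into $B$ by changing some number (possibly none) of ones to zeroes; otherwise $A$ is $B$-free. For a positive integer $n$, $\operatorname{ex}(n,M)$ is the maximum number of ones in an $M$-free $n \times n$ 0-1 matrix. The rows of $P$ are its maximal subsets with the same $y$-coordinate; the columns of $P$ are its maximal subsets with the same $x$-coordinate. For finite $P$, $M_P$ is the 0-1 matrix with the same number of rows and columns as $P$, whose rows correspond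 to the rows of $P$ in order from top to bottom and whose columns correspond to the columns of $P$ in order from left to right, with a one in each entry corresponding to a point of $P$ and zeroes elsewhere. $f(n) = \Theta(g(n))$ means there are constants $C_1, C_2 > 0$ with $C_1 g(n) \le f(n) \le C_2 g(n)$ for all sufficiently large $n$. *)

theory Defs
  imports "HOL-Analysis.Analysis" "Jordan_Normal_Form.DL_Submatrix"
begin

definition plane_contains :: "(real \<times> real) set \<Rightarrow> (real \<times> real) set \<Rightarrow> bool" where
  "plane_contains S P \<longleftrightarrow>
     (\<exists>fX fY.
        fX \<in> fst ` P \<rightarrow> fst ` S \<and> fY \<in> snd ` P \<rightarrow> snd ` S \<and>
        (\<forall>x0\<in>fst ` P. \<forall>x1\<in>fst ` P. x0 > x1 \<longrightarrow> (fX x0 - fX x1) / (x0 - x1) \<ge> 1) \<and>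
        (\<forall>y0\<in>snd ` P. \<forall>y1\<in>snd ` P. y0 > y1 \<longrightarrow> (fY y0 - fY y1) / (y0 - y1) \<ge> 1) \<and>
        (\<forall>(x, y)\<in>P. (fX x, fY y) \<in> S))"

(* For P nonempty and n > 0 this is a genuine supremum of reals: the empty set is
   admissible, and every admissible set has measure at most n^2. *)
definition opx :: "real \<Rightarrow> (real \<times> real) set \<Rightarrow> real" where
  "opx n P = (SUP S \<in> {S. open S \<and> S \<subseteq> {0..n} \<times> {0..n} \<and> \<not> plane_contains S P}.
                measure lebesgue S)"

definition zero_one_mat :: "nat mat \<Rightarrow> bool" where
  "zero_one_mat A \<longleftrightarrow> elements_mat A \<subseteq> {0, 1}"

definition mat_contains :: "nat mat \<Rightarrow> nat mat \<Rightarrow> bool" where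
  "mat_contains A B \<longleftrightarrow>
     (\<exists>I J. I \<subseteq> {..<dim_row A} \<and> J \<subseteq> {..<dim_col A} \<and>
        submatrix A I J \<in> carrier_mat (dim_row B) (dim_col B) \<and>
        (\<forall>i<dim_row B. \<forall>j<dim_col B.
           B $$ (i, j) = submatrix A I J $$ (i, j) \<or>
           submatrix A I J $$ (i, j) = 1 \<and> B $$ (i, j) = 0))"

definition num_ones :: "nat mat \<Rightarrow> nat" where
  "num_ones A = card {(i, j). i < dim_row A \<and> j < dim_col A \<and> A $$ (i, j) = 1}"

(* The maximum exists as soon as some n x n 0-1 matrix is M-free; this holds
   whenever M has a one, since then the zero matrix is M-free. *)
definition ex :: "nat \<Rightarrow> nat mat \<Rightarrow> nat" where
  "ex n M = Max {num_ones A | A. A \<in> carrier_mat n n \<and> zero_one_mat A \<and> \<not> mat_contains A M}"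

(* Rows and columns of P are identified with their y- and x-coordinates. Matrix row 0 is
   the top row, so the y-coordinates are listed in decreasing order. *)
definition pattern_mat :: "(real \<times> real) set \<Rightarrow> nat mat" where
  "pattern_mat P =
     mat (card (snd ` P)) (card (fst ` P))
       (\<lambda>(i, j). if (sorted_list_of_set (fst ` P) ! j, rev (sorted_list_of_set (snd ` P)) ! i) \<in> P
                 then 1 else 0)"

definition row_distances :: "(real \<times> real) set \<Rightarrow> real set" where
  "row_distances P = {dist y0 y1 | y0 y1. y0 \<in> snd ` P \<and> y1 \<in> snd ` P \<and> y0 \<noteq> y1}"

definition col_distances :: "(real \<times> real) set \<Rightarrow> real set" where
  "col_distances P = {dist x0 x1 | x0 x1. x0 \<in> fst ` P \<and> x1 \<in> fst ` P \<and> x0 \<noteq> x1}"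

end

theory Submission
  imports Defs
begin

text \<open>Lower bound: fill the open grid cells, of side at most the smallest column (row) distance of \<open>P\<close>,
  that correspond to the ones of an extremal \<open>M\<^sub>P\<close>-free matrix. A copy of \<open>P\<close> in this set would use
  distinct grid columns (rows) for distinct columns (rows) of \<open>P\<close>, hence give a copy of \<open>M\<^sub>P\<close>.

  Upper bound: average over all translates of a lattice whose steps are at least the largest column
  (row) distance of \<open>P\<close>. The lattice points of a translate that lie in a \<open>P\<close>-free set form an
  \<open>M\<^sub>P\<close>-free matrix, and the measure of the set is at most the integral of the number of its ones over one
  fundamental cell. The steps are also taken to be at least 1, so that \<open>n\<close> by \<open>n\<close> cells cover
  the square of side \<open>n\<close>.\<close>

section \<open>Matrix containment as order embeddings of rows and columns\<close>

text \<open>\<open>pick I i\<close> is the element of \<open>I\<close> with exactly \<open>i\<close>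
  smaller elements in \<open>I\<close>; by monotonicity the elements of the image below
  \<open>r i\<close> are the \<open>r a\<close> with \<open>a < i\<close>.\<close>

lemma pick_strict_mono_image:
  assumes r: "strict_mono_on {..<k} r" and i: "i < k"
  shows "pick (r ` {..<k}) i = (r i :: nat)"
proof -
  have less: "r a < r i \<longleftrightarrow> a < i" if "a < k" for a
    using strict_mono_on_less[OF r, of a i] that i by simp
  have "{a \<in> r ` {..<k}. a < r i} = r ` {..<i}"
    using less i by fastforce
  moreover have "card (r ` {..<i}) = i"
    using card_image[OF inj_on_subset[OF strict_mono_on_imp_inj_on[OF r]], of "{..<i}"] i by auto
  ultimately show ?thesis
    using pick_card_in_set[of "r i" "r ` {..<k}"] i by simp
qed

text \<open>Index sets and increasing index maps determine each other: \<open>pick\<close>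
  enumerates a set, and the image recovers the set from the map. For 0-1 entries, turning ones to
  zeroes means that every one of \<open>B\<close> sits over a one of \<open>A\<close>.\<close>

lemma mat_contains_iff:
  assumes A: "zero_one_mat A" and B: "zero_one_mat B"
  shows "mat_contains A B \<longleftrightarrow>
    (\<exists>r c. strict_mono_on {..<dim_row B} r \<and> r \<in> {..<dim_row B} \<rightarrow> {..<dim_row A} \<and>
           strict_mono_on {..<dim_col B} c \<and> c \<in> {..<dim_col B} \<rightarrow> {..<dim_col A} \<and>
           (\<forall>i<dim_row B. \<forall>j<dim_col B. B $$ (i, j) = 1 \<longrightarrow> A $$ (r i, c j) = 1))"
    (is "_ = (\<exists>r c. ?emb r c)")
proof
  assume "mat_contains A B"
  then obtain I J where I: "I \<subseteq> {..<dim_row A}" and J: "J \<subseteq> {..<dim_col A}"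
    and sub: "submatrix A I J \<in> carrier_mat (dim_row B) (dim_col B)"
    and le: "\<And>i j. i < dim_row B \<Longrightarrow> j < dim_col B \<Longrightarrow> B $$ (i, j) = submatrix A I J $$ (i, j) \<or>
           submatrix A I J $$ (i, j) = 1 \<and> B $$ (i, j) = 0"
    unfolding mat_contains_def by blast
  \<comment> \<open>The dimensions of \<open>submatrix\<close> count only those members of
    \<open>I\<close> and \<open>J\<close> that are valid indices of \<open>A\<close>; here that is
    all of them.\<close>
  have "{i. i < dim_row A \<and> i \<in> I} = I" "{j. j < dim_col A \<and> j \<in> J} = J"
    using I J by auto
  then have card: "card I = dim_row B" "card J = dim_col B"
    and entry: "\<And>i j. i < card I \<Longrightarrow> j < card J \<Longrightarrow> submatrix A I J $$ (i, j) = A $$ (pick I i, pick J j)"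
    using sub dim_submatrix[of A I J] submatrix_index[of _ A I _ J] by auto
  have "?emb (pick I) (pick J)"
  proof (intro conjI allI impI)
    show "strict_mono_on {..<dim_row B} (pick I)" "strict_mono_on {..<dim_col B} (pick J)"
      using pick_mono_le card by (auto intro!: strict_mono_onI)
    show "pick I \<in> {..<dim_row B} \<rightarrow> {..<dim_row A}" "pick J \<in> {..<dim_col B} \<rightarrow> {..<dim_col A}"
      using pick_in_set_le[of _ I] pick_in_set_le[of _ J] card I J by auto
    show "A $$ (pick I i, pick J j) = 1"
      if "i < dim_row B" "j < dim_col B" "B $$ (i, j) = 1" for i j
      using le[OF that(1,2)] entry[of i j] card that by auto
  qed
  then show "\<exists>r c. ?emb r c" by blast
next
  assume "\<exists>r c. ?emb r c"
  then obtain r c where r: "strict_mono_on {..<dim_row B} r" "r \<in> {..<dim_row B} \<rightarrow> {..<dim_row A}"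
    and c: "strict_mono_on {..<dim_col B} c" "c \<in> {..<dim_col B} \<rightarrow> {..<dim_col A}"
    and one: "\<And>i j. i < dim_row B \<Longrightarrow> j < dim_col B \<Longrightarrow> B $$ (i, j) = 1 \<Longrightarrow> A $$ (r i, c j) = 1"
    by blast
  define I J where "I = r ` {..<dim_row B}" and "J = c ` {..<dim_col B}"
  have IJ: "{i. i < dim_row A \<and> i \<in> I} = I" "{j. j < dim_col A \<and> j \<in> J} = J"
    using r(2) c(2) by (auto simp: I_def J_def)
  have card: "card I = dim_row B" "card J = dim_col B"
    using strict_mono_on_imp_inj_on[OF r(1)] strict_mono_on_imp_inj_on[OF c(1)]
    by (auto simp: I_def J_def card_image)
  have dim: "submatrix A I J \<in> carrier_mat (dim_row B) (dim_col B)"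
    using card IJ dim_submatrix[of A I J] by (auto intro!: carrier_matI)
  have entry: "submatrix A I J $$ (i, j) = A $$ (r i, c j)" if "i < dim_row B" "j < dim_col B" for i j
    using that IJ card submatrix_index[of i A I j J]
      pick_strict_mono_image[OF r(1) that(1)] pick_strict_mono_image[OF c(1) that(2)]
    by (simp add: I_def[symmetric] J_def[symmetric])
  show "mat_contains A B"
    unfolding mat_contains_def
  proof (intro exI conjI allI impI)
    show "I \<subseteq> {..<dim_row A}" "J \<subseteq> {..<dim_col A}"
      using r(2) c(2) by (auto simp: I_def J_def)
    show "submatrix A I J \<in> carrier_mat (dim_row B) (dim_col B)" by (fact dim)
    fix i j assume ij: "i < dim_row B" "j < dim_col B"
    have "r i < dim_row A" "c j < dim_col A" using ij r(2) c(2) by auto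
    then have "A $$ (r i, c j) \<in> {0, 1}" "B $$ (i, j) \<in> {0, 1}"
      using A B ij by (auto simp: zero_one_mat_def)
    then show "B $$ (i, j) = submatrix A I J $$ (i, j) \<or>
           submatrix A I J $$ (i, j) = 1 \<and> B $$ (i, j) = 0"
      using entry[OF ij] one[OF ij] by auto
  qed
qed

lemma zero_one_mat_mat:
  assumes "\<And>i j. i < m \<Longrightarrow> j < n \<Longrightarrow> f (i, j) \<in> {0, 1}"
  shows "zero_one_mat (mat m n f)"
  using assms by (fastforce simp: zero_one_mat_def)

lemma zero_one_pattern_mat: "zero_one_mat (pattern_mat P)"
  unfolding pattern_mat_def by (rule zero_one_mat_mat) auto

text \<open>Both bounds build or use a copy of \<open>P\<close> by its coordinates, so the embedding
  is re-indexed by the coordinates themselves. The row map is decreasing because row 0 is the top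
  row.\<close>

lemma mat_contains_pattern_mat_iff:
  assumes P: "finite P" and A: "zero_one_mat A"
  shows "mat_contains A (pattern_mat P) \<longleftrightarrow>
    (\<exists>g h. strict_antimono_on (snd ` P) g \<and> g \<in> snd ` P \<rightarrow> {..<dim_row A} \<and>
           strict_mono_on (fst ` P) h \<and> h \<in> fst ` P \<rightarrow> {..<dim_col A} \<and>
           (\<forall>(x, y)\<in>P. A $$ (g y, h x) = 1))"
    (is "_ = (\<exists>g h. ?emb g h)")
proof -
  define X Y where "X = fst ` P" and "Y = snd ` P"
  define px py where "px = (\<lambda>j. sorted_list_of_set X ! j)" and "py = (\<lambda>i. rev (sorted_list_of_set Y) ! i)"
  have fin: "finite X" "finite Y" using P by (auto simp: X_def Y_def)
  have px: "bij_betw px {..<card X} X"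
    unfolding px_def using fin by (intro bij_betw_nth) auto
  have py: "bij_betw py {..<card Y} Y"
    unfolding py_def using fin by (intro bij_betw_nth) auto
  have px_mono: "px i < px j" if "i < j" "j < card X" for i j
    using sorted_wrt_nth_less[OF strict_sorted_list_of_set, of i j X] that by (simp add: px_def)
  \<comment> \<open>\<open>rev_nth\<close> replaces the index \<open>i\<close> by
    \<open>card Y - Suc i\<close>, which swaps the order of \<open>i\<close> and
    \<open>j\<close>.\<close>
  have py_mono: "py j < py i" if "i < j" "j < card Y" for i j
    using sorted_wrt_nth_less[OF strict_sorted_list_of_set, of "card Y - Suc j" "card Y - Suc i" Y] that
    by (simp add: py_def rev_nth)
  \<comment> \<open>The position of a coordinate in the sorted list; composing with it turns an
    index map into a coordinate map.\<close>
  define ix iy where "ix = inv_into {..<card X} px" and "iy = inv_into {..<card Y} py"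
  have ix: "ix x < card X" "px (ix x) = x" if "x \<in> X" for x
    using that px unfolding ix_def bij_betw_def
    by (auto intro: f_inv_into_f) (metis inv_into_into lessThan_iff)
  have iy: "iy y < card Y" "py (iy y) = y" if "y \<in> Y" for y
    using that py unfolding iy_def bij_betw_def
    by (auto intro: f_inv_into_f) (metis inv_into_into lessThan_iff)
  have ix_mono: "ix x < ix x'" if "x \<in> X" "x' \<in> X" "x < x'" for x x'
    using px_mono[of "ix x'" "ix x"] ix that by (metis linorder_neqE order_less_asym)
  have iy_mono: "iy y' < iy y" if "y \<in> Y" "y' \<in> Y" "y < y'" for y y'
    using py_mono[of "iy y" "iy y'"] iy that by (metis linorder_neqE order_less_asym)
  have dim: "dim_row (pattern_mat P) = card Y" "dim_col (pattern_mat P) = card X"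
    by (auto simp: pattern_mat_def X_def Y_def)
  have entry: "pattern_mat P $$ (i, j) = 1 \<longleftrightarrow> (px j, py i) \<in> P" if "i < card Y" "j < card X" for i j
    using that by (simp add: pattern_mat_def px_def py_def X_def Y_def)
  show ?thesis
    unfolding mat_contains_iff[OF A zero_one_pattern_mat] dim X_def[symmetric] Y_def[symmetric]
  proof safe
    fix r c
    assume r: "strict_mono_on {..<card Y} r" "r \<in> {..<card Y} \<rightarrow> {..<dim_row A}"
      and c: "strict_mono_on {..<card X} c" "c \<in> {..<card X} \<rightarrow> {..<dim_col A}"
      and one: "\<forall>i<card Y. \<forall>j<card X. pattern_mat P $$ (i, j) = 1 \<longrightarrow> A $$ (r i, c j) = 1"
    show "\<exists>g h. strict_antimono_on Y g \<and> g \<in> Y \<rightarrow> {..<dim_row A} \<and> strict_mono_on X h \<and>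
            h \<in> X \<rightarrow> {..<dim_col A} \<and> (\<forall>(x, y)\<in>P. A $$ (g y, h x) = 1)"
    proof (intro exI conjI)
      show "strict_antimono_on Y (r \<circ> iy)"
        using iy iy_mono strict_mono_onD[OF r(1)] by (auto intro!: monotone_onI)
      show "strict_mono_on X (c \<circ> ix)"
        using ix ix_mono strict_mono_onD[OF c(1)] by (auto intro!: strict_mono_onI)
      show "r \<circ> iy \<in> Y \<rightarrow> {..<dim_row A}" "c \<circ> ix \<in> X \<rightarrow> {..<dim_col A}"
        using r(2) c(2) ix iy by auto
      show "\<forall>(x, y)\<in>P. A $$ ((r \<circ> iy) y, (c \<circ> ix) x) = 1"
      proof clarsimp
        fix x y assume xy: "(x, y) \<in> P"
        then have "x \<in> X" "y \<in> Y" by (force simp: X_def Y_def)+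
        then show "A $$ (r (iy y), c (ix x)) = Suc 0"
          using one entry[of "iy y" "ix x"] ix[of x] iy[of y] xy by simp
      qed
    qed
  next
    fix g h
    assume g: "strict_antimono_on Y g" "g \<in> Y \<rightarrow> {..<dim_row A}"
      and h: "strict_mono_on X h" "h \<in> X \<rightarrow> {..<dim_col A}"
      and one: "\<forall>(x, y)\<in>P. A $$ (g y, h x) = 1"
    have pxX: "px j \<in> X" if "j < card X" for j using px that by (auto simp: bij_betw_def)
    have pyY: "py j \<in> Y" if "j < card Y" for j using py that by (auto simp: bij_betw_def)
    show "\<exists>r c. strict_mono_on {..<card Y} r \<and> r \<in> {..<card Y} \<rightarrow> {..<dim_row A} \<and>
             strict_mono_on {..<card X} c \<and> c \<in> {..<card X} \<rightarrow> {..<dim_col A} \<and>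
             (\<forall>i<card Y. \<forall>j<card X. pattern_mat P $$ (i, j) = 1 \<longrightarrow> A $$ (r i, c j) = 1)"
    proof (intro exI conjI)
      show "strict_mono_on {..<card Y} (g \<circ> py)"
        using monotone_onD[OF g(1)] py_mono pyY by (auto intro!: strict_mono_onI)
      show "strict_mono_on {..<card X} (h \<circ> px)"
        using strict_mono_onD[OF h(1)] px_mono pxX by (auto intro!: strict_mono_onI)
      show "g \<circ> py \<in> {..<card Y} \<rightarrow> {..<dim_row A}" "h \<circ> px \<in> {..<card X} \<rightarrow> {..<dim_col A}"
        using g(2) h(2) pxX pyY by auto
      show "\<forall>i<card Y. \<forall>j<card X. pattern_mat P $$ (i, j) = 1 \<longrightarrow> A $$ ((g \<circ> py) i, (h \<circ> px) j) = 1"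
        using entry one by auto
    qed
  qed
qed

section \<open>The extremal number as an attained maximum\<close>

lemma finite_free_num_ones:
  "finite {num_ones A | A. A \<in> carrier_mat n n \<and> zero_one_mat A \<and> \<not> mat_contains A M}"
proof (rule finite_subset)
  show "{num_ones A | A. A \<in> carrier_mat n n \<and> zero_one_mat A \<and> \<not> mat_contains A M} \<subseteq> {..n * n}"
  proof clarsimp
    fix A :: "nat mat" assume A: "A \<in> carrier_mat n n"
    have "num_ones A \<le> card ({..<n} \<times> {..<n})"
      unfolding num_ones_def using A by (intro card_mono) auto
    then show "num_ones A \<le> n * n" by simp
  qed
qed simp

lemma num_ones_le_ex:
  assumes "A \<in> carrier_mat n n" "zero_one_mat A" "\<not> mat_contains A M"
  shows "num_ones A \<le> ex n M"
  unfolding ex_def using assms by (intro Max_ge finite_free_num_ones) blast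

text \<open>The zero matrix keeps the family nonempty: a point of \<open>P\<close> demands a one
  that it does not have.\<close>

lemma ex_attained:
  assumes P: "finite P" "P \<noteq> {}"
  obtains A where "A \<in> carrier_mat n n" "zero_one_mat A" "\<not> mat_contains A (pattern_mat P)"
    "num_ones A = ex n (pattern_mat P)"
proof -
  let ?Z = "mat n n (\<lambda>_. 0) :: nat mat"
  have Z: "zero_one_mat ?Z" by (rule zero_one_mat_mat) simp
  obtain x y where xy: "(x, y) \<in> P" using P(2) by auto
  have "\<not> mat_contains ?Z (pattern_mat P)"
  proof
    assume "mat_contains ?Z (pattern_mat P)"
    then obtain g h where "g \<in> snd ` P \<rightarrow> {..<n}" "h \<in> fst ` P \<rightarrow> {..<n}"
      "\<forall>(x, y)\<in>P. ?Z $$ (g y, h x) = 1"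
      unfolding mat_contains_pattern_mat_iff[OF P(1) Z] by auto
    moreover from this have "g y < n" "h x < n" using xy by force+
    ultimately show False using xy by fastforce
  qed
  then have "num_ones ?Z \<in> {num_ones A | A. A \<in> carrier_mat n n \<and> zero_one_mat A \<and> \<not> mat_contains A (pattern_mat P)}"
    using Z by force
  then have "ex n (pattern_mat P) \<in> {num_ones A | A. A \<in> carrier_mat n n \<and> zero_one_mat A \<and> \<not> mat_contains A (pattern_mat P)}"
    unfolding ex_def by (intro Max_in finite_free_num_ones) blast
  then show thesis using that by auto
qed


section \<open>Lower bound: an open free set built from a free matrix\<close>

text \<open>After division by \<open>d\<close> the gap is at least 1, so the floors differ.
  Nonnegativity of \<open>s\<close> keeps \<open>nat\<close> from collapsing negative floors to
  0.\<close>

lemma nat_floor_divide_less: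
  fixes d s t :: real
  assumes "0 < d" "0 \<le> s" "d \<le> t - s"
  shows "nat \<lfloor>s / d\<rfloor> < nat \<lfloor>t / d\<rfloor>"
proof -
  have "(s + d) / d \<le> t / d" using assms by (intro divide_right_mono) auto
  then have "s / d + 1 \<le> t / d" using assms(1) by (simp add: add_divide_distrib)
  then have "\<lfloor>s / d\<rfloor> + 1 \<le> \<lfloor>t / d\<rfloor>" using floor_mono by fastforce
  moreover have "0 \<le> \<lfloor>s / d\<rfloor>" using assms by simp
  ultimately show ?thesis by linarith
qed

lemma nat_floor_divide_eqI:
  fixes d t :: real
  assumes "0 < d" "real k * d < t" "t < real (Suc k) * d"
  shows "nat \<lfloor>t / d\<rfloor> = k"
proof -
  have "\<lfloor>t / d\<rfloor> = int k" using assms by (intro floor_unique) (auto simp: field_simps)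
  then show ?thesis by simp
qed

text \<open>Containment never shrinks distances, so distinct columns of \<open>P\<close> land at
  least \<open>dx\<close> apart, hence in different grid columns; likewise for rows. The bounds by 1
  keep the grid inside the square.\<close>

lemma open_free_set_from_mat:
  fixes dx dy :: real
  assumes P: "finite P"
    and dx: "0 < dx" "dx \<le> 1" "\<And>x x'. x \<in> fst ` P \<Longrightarrow> x' \<in> fst ` P \<Longrightarrow> x' < x \<Longrightarrow> dx \<le> x - x'"
    and dy: "0 < dy" "dy \<le> 1" "\<And>y y'. y \<in> snd ` P \<Longrightarrow> y' \<in> snd ` P \<Longrightarrow> y' < y \<Longrightarrow> dy \<le> y - y'"
    and A: "A \<in> carrier_mat n n" "zero_one_mat A" "\<not> mat_contains A (pattern_mat P)"
  obtains S where "open S" "S \<subseteq> {0..real n} \<times> {0..real n}" "\<not> plane_contains S P"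
    "measure lebesgue S = dx * dy * real (num_ones A)"
proof -
  define K where "K = {(i, j). i < n \<and> j < n \<and> A $$ (i, j) = 1}"
  \<comment> \<open>Matrix row 0 is the top row, so row \<open>i\<close> lies at height \<open>n - Suc i\<close>.\<close>
  define cell where "cell = (\<lambda>(i, j). box (real j * dx, real (n - Suc i) * dy)
                                         (real (Suc j) * dx, real (Suc (n - Suc i)) * dy))"
  define S where "S = (\<Union>k\<in>K. cell k)"
  have "finite K" by (rule finite_subset[of _ "{..<n} \<times> {..<n}"]) (auto simp: K_def)
  have cell: "cell (i, j) = {real j * dx<..<real (Suc j) * dx} \<times>
      {real (n - Suc i) * dy<..<real (Suc (n - Suc i)) * dy}" for i j
    by (simp add: cell_def box_prod)
  \<comment> \<open>The floors of the scaled coordinates recover the cell. This serves three times: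
    for \<open>S\<close> lying in the square, for reading a matrix position off a point, and for
    disjointness of the cells.\<close>
  have index: "j = nat \<lfloor>x / dx\<rfloor> \<and> n - Suc i = nat \<lfloor>y / dy\<rfloor> \<and> 0 \<le> x \<and> x \<le> real n \<and> 0 \<le> y \<and> y \<le> real n"
    if k: "(i, j) \<in> K" and xy: "(x, y) \<in> cell (i, j)" for i j x y
  proof -
    have ij: "i < n" "j < n" using k by (auto simp: K_def)
    have x: "real j * dx < x" "x < real (Suc j) * dx"
      and y: "real (n - Suc i) * dy < y" "y < real (Suc (n - Suc i)) * dy"
      using xy by (auto simp: cell)
    have "real (Suc j) * dx \<le> real n * 1" "real (Suc (n - Suc i)) * dy \<le> real n * 1"
      using ij dx(1,2) dy(1,2) by (intro mult_mono; simp)+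
    moreover have "0 \<le> real j * dx" "0 \<le> real (n - Suc i) * dy" using dx dy by auto
    ultimately show ?thesis
      using nat_floor_divide_eqI[OF dx(1) x] nat_floor_divide_eqI[OF dy(1) y] x y by auto
  qed
  have "open S" unfolding S_def cell_def by auto
  moreover have "S \<subseteq> {0..real n} \<times> {0..real n}"
  proof clarify
    fix x y assume "(x, y) \<in> S"
    then obtain i j where "(i, j) \<in> K" "(x, y) \<in> cell (i, j)" by (auto simp: S_def)
    from index[OF this] show "x \<in> {0..real n} \<and> y \<in> {0..real n}" by simp
  qed
  moreover have "\<not> plane_contains S P"
  proof
    assume "plane_contains S P"
    then obtain fX fY where
      fX: "\<forall>x\<in>fst ` P. \<forall>x'\<in>fst ` P. x > x' \<longrightarrow> (fX x - fX x') / (x - x') \<ge> 1"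
      and fY: "\<forall>y\<in>snd ` P. \<forall>y'\<in>snd ` P. y > y' \<longrightarrow> (fY y - fY y') / (y - y') \<ge> 1"
      and S: "\<forall>(x, y)\<in>P. (fX x, fY y) \<in> S"
      unfolding plane_contains_def by (elim exE conjE) (rule that)
    define h where "h x = nat \<lfloor>fX x / dx\<rfloor>" for x
    \<comment> \<open>The floor counts grid rows from the bottom, matrix rows are counted from the
      top.\<close>
    define g where "g y = n - Suc (nat \<lfloor>fY y / dy\<rfloor>)" for y
    \<comment> \<open>The side conditions guard against truncation: without them \<open>nat\<close>
      and \<open>n - Suc\<close> need not be strictly monotone.\<close>
    have hit: "(g y, h x) \<in> K \<and> 0 \<le> fX x \<and> 0 \<le> fY y \<and> nat \<lfloor>fY y / dy\<rfloor> < n" if xy: "(x, y) \<in> P" for x y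
    proof -
      obtain i j where ij: "(i, j) \<in> K" "(fX x, fY y) \<in> cell (i, j)"
        using S xy by (auto simp: S_def)
      then have "i < n" by (auto simp: K_def)
      note idx = index[OF ij]
      from idx have "g y = n - Suc (n - Suc i)" by (simp add: g_def)
      then have "g y = i" "h x = j" using \<open>i < n\<close> idx by (auto simp: h_def)
      moreover have "nat \<lfloor>fY y / dy\<rfloor> < n" using idx \<open>i < n\<close> by linarith
      ultimately show ?thesis using idx ij(1) by simp
    qed
    have "mat_contains A (pattern_mat P)"
      unfolding mat_contains_pattern_mat_iff[OF P A(2)]
    proof (intro exI conjI)
      show "strict_antimono_on (snd ` P) g"
      proof (rule monotone_onI)
        fix y' y assume y: "y' \<in> snd ` P" "y \<in> snd ` P" "y' < y"
        then have "1 \<le> (fY y - fY y') / (y - y')" "dy \<le> y - y'" using fY dy(3) by blast+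
        then have "dy \<le> fY y - fY y'" using y(3) by (simp add: field_simps)
        moreover have "0 \<le> fY y'" "nat \<lfloor>fY y / dy\<rfloor> < n" using hit y by fastforce+
        ultimately show "g y < g y'"
          using nat_floor_divide_less[OF dy(1), of "fY y'" "fY y"] unfolding g_def by linarith
      qed
      show "strict_mono_on (fst ` P) h"
      proof (rule strict_mono_onI)
        fix x' x assume x: "x' \<in> fst ` P" "x \<in> fst ` P" "x' < x"
        then have "1 \<le> (fX x - fX x') / (x - x')" "dx \<le> x - x'" using fX dx(3) by blast+
        then have "dx \<le> fX x - fX x'" using x(3) by (simp add: field_simps)
        moreover have "0 \<le> fX x'" using hit x by fastforce
        ultimately show "h x' < h x"
          using nat_floor_divide_less[OF dx(1)] unfolding h_def by blast
      qed
      show "g \<in> snd ` P \<rightarrow> {..<dim_row A}" "h \<in> fst ` P \<rightarrow> {..<dim_col A}"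
        using hit A(1) by (fastforce simp: K_def)+
      show "\<forall>(x, y)\<in>P. A $$ (g y, h x) = 1"
        using hit by (auto simp: K_def)
    qed
    then show False using A(3) by simp
  qed
  moreover have "measure lebesgue S = dx * dy * real (num_ones A)"
  proof -
    have disj: "pairwise (\<lambda>k l. disjnt (cell k) (cell l)) K"
    proof (rule pairwiseI)
      fix k l assume kl: "k \<in> K" "l \<in> K" "k \<noteq> l"
      obtain i j i' j' where [simp]: "k = (i, j)" "l = (i', j')" by fastforce
      have lt: "i < n" "i' < n" using kl by (auto simp: K_def)
      show "disjnt (cell k) (cell l)"
        unfolding disjnt_iff
      proof safe
        fix x y assume "(x, y) \<in> cell k" "(x, y) \<in> cell l"
        then have "j = j'" "n - Suc i = n - Suc i'" using index[of i j x y] index[of i' j' x y] kl by auto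
        \<comment> \<open>The truncated differences determine \<open>i\<close> and \<open>i'\<close>
          because both are below \<open>n\<close>.\<close>
        then show False using lt kl(3) by auto
      qed
    qed
    have "measure lebesgue (cell k) = dx * dy" if "k \<in> K" for k
    proof -
      obtain i j where k: "k = (i, j)" by fastforce
      show ?thesis
        using dx dy unfolding k cell_def by (simp add: content_Pair measure_lborel_box_eq Basis_prod_def algebra_simps)
    qed
    then have "measure lebesgue S = (\<Sum>k\<in>K. dx * dy)"
      unfolding S_def using \<open>finite K\<close> disj
      by (subst measure_UNION') (auto simp: cell_def)
    also have "\<dots> = dx * dy * real (card K)" by simp
    also have "K = {(i, j). i < dim_row A \<and> j < dim_col A \<and> A $$ (i, j) = 1}"
      using A(1) by (auto simp: K_def)
    finally show ?thesis by (simp add: num_ones_def)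
  qed
  ultimately show thesis by (rule that)
qed

section \<open>Upper bound: averaging over translated lattices\<close>

text \<open>Moving to a later lattice column shifts by at least \<open>Lx\<close>, hence by at least
  the distance of any two columns of \<open>P\<close>; so every copy of the pattern among lattice
  points is a copy of \<open>P\<close> in the plane.\<close>

lemma measure_open_free_le:
  fixes Lx Ly :: real
  assumes P: "finite P"
    and Lx: "1 \<le> Lx" "\<And>x x'. x \<in> fst ` P \<Longrightarrow> x' \<in> fst ` P \<Longrightarrow> x' < x \<Longrightarrow> x - x' \<le> Lx"
    and Ly: "1 \<le> Ly" "\<And>y y'. y \<in> snd ` P \<Longrightarrow> y' \<in> snd ` P \<Longrightarrow> y' < y \<Longrightarrow> y - y' \<le> Ly"
    and S: "open S" "S \<subseteq> {0..real n} \<times> {0..real n}" "\<not> plane_contains S P"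
  shows "measure lebesgue S \<le> Lx * Ly * real (ex n (pattern_mat P))"
\<comment> \<open>An open subset of a single point is empty. For positive \<open>n\<close>, the
  index \<open>n - 1\<close> used below is a valid one.\<close>
proof (cases "n = 0")
  case True
  then have "S \<subseteq> {(0, 0)}" using S(2) by auto
  then have "S = {}" using S(1) not_open_singleton[of "(0::real, 0::real)"] by (auto simp: subset_singleton_iff)
  then show ?thesis using Lx Ly by simp
next
  case False
  define K where "K = {..<n} \<times> {..<n}"
  \<comment> \<open>\<open>c k\<close> is the lower left corner of grid cell \<open>k\<close>,
    \<open>Q\<close> is the cell at the origin, and \<open>T k\<close> is the part of
    \<open>S\<close> in cell \<open>k\<close> moved back to \<open>Q\<close>.\<close>
  define c where "c = (\<lambda>(i, j). (real j * Lx, real (n - Suc i) * Ly))"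
  define Q where "Q = {0..Lx} \<times> {0..Ly}"
  define T where "T k = (\<lambda>p. c k + p) -` S \<inter> Q" for k
  have "finite K" by (simp add: K_def)
  have Q: "Q \<in> sets borel" "emeasure lborel Q = ennreal (Lx * Ly)"
  proof -
    have Q: "Q = cbox (0, 0) (Lx, Ly)" by (simp add: Q_def cbox_Pair_eq)
    then show "Q \<in> sets borel" by simp
    show "emeasure lborel Q = ennreal (Lx * Ly)"
      unfolding Q using Lx Ly by (subst emeasure_lborel_cbox) (auto simp: Basis_prod_def)
  qed
  have T: "T k \<in> sets borel" for k
  proof -
    have "open ((\<lambda>p. c k + p) -` S)" using S(1) by (intro open_vimage continuous_intros)
    then show ?thesis unfolding T_def by (intro sets.Int Q(1)) auto
  qed
  have cover: "\<exists>m<n. \<exists>u\<in>{0..L}. t = real m * L + u" if "1 \<le> L" "0 \<le> t" "t \<le> real n" for L t :: real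
  proof -
    \<comment> \<open>The cap takes effect only for \<open>L = 1\<close> and \<open>t = n\<close>,
      where the floor is \<open>n\<close>; the closed last cell still contains that point.\<close>
    define m where "m = min (n - 1) (nat \<lfloor>t / L\<rfloor>)"
    have "real (nat \<lfloor>t / L\<rfloor>) \<le> t / L" "t / L \<le> real (nat \<lfloor>t / L\<rfloor>) + 1"
      using that by (auto simp: floor_le_iff)
    moreover have "t / L \<le> real n"
      using that by (smt (verit) divide_le_eq mult_left_le_one_le mult_le_cancel_left1 of_nat_0_le_iff)
    ultimately have "real m \<le> t / L" "t / L \<le> real m + 1"
      using False unfolding m_def by linarith+
    then have "real m * L \<le> t" "t \<le> real m * L + L" using that by (auto simp: field_simps)
    then show ?thesis using False by (intro exI[of _ m] conjI bexI[of _ "t - real m * L"]) (auto simp: m_def)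
  qed
  have S_cover: "S \<subseteq> (\<Union>k\<in>K. (\<lambda>p. c k + p) ` T k)"
  proof clarsimp
    fix x y assume xy: "(x, y) \<in> S"
    obtain j u where j: "j < n" "u \<in> {0..Lx}" "x = real j * Lx + u"
      using cover[OF Lx(1), of x] xy S(2) by fastforce
    obtain i v where i: "i < n" "v \<in> {0..Ly}" "y = real i * Ly + v"
      using cover[OF Ly(1), of y] xy S(2) by fastforce
    \<comment> \<open>\<open>c\<close> flips the row index, so height \<open>i * Ly\<close> belongs
      to matrix row \<open>n - Suc i\<close>.\<close>
    have "(x, y) = c (n - Suc i, j) + (u, v)" using i j by (simp add: c_def Suc_diff_Suc)
    then show "\<exists>k\<in>K. (x, y) \<in> (+) (c k) ` T k"
      using i j xy by (intro bexI[of _ "(n - Suc i, j)"] image_eqI[of _ _ "(u, v)"]) (auto simp: T_def Q_def K_def)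
  qed
  have trans: "emeasure lborel ((\<lambda>p. c k + p) ` T k) = emeasure lborel (T k)"
    "(\<lambda>p. c k + p) ` T k \<in> sets borel" for k
  proof -
    \<comment> \<open>As a preimage under the inverse translation, the image is measurable, and
      translation invariance of \<open>lborel\<close> applies.\<close>
    have im: "(\<lambda>p. c k + p) ` T k = (\<lambda>p. - c k + p) -` T k"
    proof (intro equalityI subsetI)
      fix q assume "q \<in> (+) (- c k) -` T k"
      then show "q \<in> (+) (c k) ` T k" by (intro image_eqI[of q _ "- c k + q"]) auto
    qed auto
    show "(\<lambda>p. c k + p) ` T k \<in> sets borel"
      unfolding im using measurable_sets[OF _ T, of "\<lambda>p. - c k + p" borel k]
      by (simp only: space_borel Int_UNIV_right borel_measurable_const_add measurable_ident_sets)
    have "emeasure lborel (T k) = emeasure (distr lborel borel (\<lambda>p. - c k + p)) (T k)"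
      by (subst lborel_distr_plus) simp
    also have "\<dots> = emeasure lborel ((\<lambda>p. - c k + p) -` T k)"
      using T by (subst emeasure_distr) auto
    finally show "emeasure lborel ((\<lambda>p. c k + p) ` T k) = emeasure lborel (T k)"
      by (simp add: im)
  qed
  \<comment> \<open>One translate of the lattice: its points in \<open>S\<close> are the ones of a
    pattern-free matrix, whatever the offset \<open>p\<close>.\<close>
  have sample: "card {k \<in> K. c k + p \<in> S} \<le> ex n (pattern_mat P)" for p
  proof -
    define A where "A = mat n n (\<lambda>k. if c k + p \<in> S then 1 else 0 :: nat)"
    have A: "A \<in> carrier_mat n n" "zero_one_mat A"
      unfolding A_def by (simp, rule zero_one_mat_mat) simp
    have "\<not> mat_contains A (pattern_mat P)"
    proof
      assume "mat_contains A (pattern_mat P)"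
      then obtain g h where g: "strict_antimono_on (snd ` P) g" "g \<in> snd ` P \<rightarrow> {..<n}"
        and h: "strict_mono_on (fst ` P) h" "h \<in> fst ` P \<rightarrow> {..<n}"
        and one: "\<forall>(x, y)\<in>P. A $$ (g y, h x) = 1"
        using A(1) unfolding mat_contains_pattern_mat_iff[OF P A(2)] by auto
      define fX where "fX x = real (h x) * Lx + fst p" for x
      define fY where "fY y = real (n - Suc (g y)) * Ly + snd p" for y
      have in_S: "(fX x, fY y) \<in> S" if xy: "(x, y) \<in> P" for x y
      proof -
        have "g y < n" "h x < n" using xy g(2) h(2) by force+
        then have "c (g y, h x) + p \<in> S" using one xy by (fastforce simp: A_def split: if_splits)
        then show ?thesis by (simp add: c_def fX_def fY_def plus_prod_def)
      qed
      have step: "1 \<le> (real a * L - real b * L) / (t - s)"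
        if "b < a" "s < t" "t - s \<le> L" for a b :: nat and L s t :: real
      proof -
        have "1 * L \<le> (real a - real b) * L" using that by (intro mult_right_mono) auto
        then show ?thesis using that by (simp add: field_simps)
      qed
      have "plane_contains S P"
        unfolding plane_contains_def
      proof (intro exI conjI ballI impI)
        show "fX \<in> fst ` P \<rightarrow> fst ` S" "fY \<in> snd ` P \<rightarrow> snd ` S"
          using in_S by force+
        show "1 \<le> (fX x0 - fX x1) / (x0 - x1)"
          if "x0 \<in> fst ` P" "x1 \<in> fst ` P" "x1 < x0" for x0 x1
          using step[of "h x1" "h x0" x1 x0 Lx] strict_mono_onD[OF h(1) that(2,1,3)] that Lx(2)
          by (simp add: fX_def)
        show "1 \<le> (fY y0 - fY y1) / (y0 - y1)"
          if "y0 \<in> snd ` P" "y1 \<in> snd ` P" "y1 < y0" for y0 y1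
        proof -
          \<comment> \<open>\<open>g\<close> decreases and \<open>n - Suc\<close> reverses again;
            \<open>g y1 < n\<close> makes the resulting inequality strict.\<close>
          have "g y0 < g y1" using monotone_onD[OF g(1) that(2,1,3)] by simp
          moreover have "g y1 < n" using g(2) that by auto
          ultimately show ?thesis
            using step[of "n - Suc (g y1)" "n - Suc (g y0)" y1 y0 Ly] that Ly(2)
            by (simp add: fY_def)
        qed
        show "case p of (x, y) \<Rightarrow> (fX x, fY y) \<in> S" if "p \<in> P" for p
          using in_S that by auto
      qed
      then show False using S(3) by simp
    qed
    then have "num_ones A \<le> ex n (pattern_mat P)" using A by (intro num_ones_le_ex)
    moreover have "{k \<in> K. c k + p \<in> S} = {(i, j). i < dim_row A \<and> j < dim_col A \<and> A $$ (i, j) = 1}"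
      by (auto simp: A_def K_def split: if_splits)
    ultimately show ?thesis by (simp add: num_ones_def)
  qed
  \<comment> \<open>Adjacent closed cells share edges; subadditivity suffices for an upper bound.
    Exchanging sum and integral then turns the total measure into an integral over \<open>Q\<close>
    of the number of lattice points in \<open>S\<close>.\<close>
  have "emeasure lborel S \<le> emeasure lborel (\<Union>k\<in>K. (\<lambda>p. c k + p) ` T k)"
    using S_cover trans(2) \<open>finite K\<close> by (intro emeasure_mono) auto
  also have "\<dots> \<le> (\<Sum>k\<in>K. emeasure lborel ((\<lambda>p. c k + p) ` T k))"
    using trans(2) \<open>finite K\<close> by (intro emeasure_subadditive_finite) auto
  also have "\<dots> = (\<Sum>k\<in>K. \<integral>\<^sup>+p. indicator (T k) p \<partial>lborel)"
    using T by (simp add: trans)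
  also have "\<dots> = (\<integral>\<^sup>+p. (\<Sum>k\<in>K. indicator (T k) p) \<partial>lborel)"
    using T by (intro nn_integral_sum[symmetric]) auto
  also have "\<dots> \<le> (\<integral>\<^sup>+p. of_nat (ex n (pattern_mat P)) * indicator Q p \<partial>lborel)"
  proof (rule nn_integral_mono)
    fix p :: "real \<times> real"
    have "(\<Sum>k\<in>K. indicator (T k) p) = (\<Sum>k\<in>K. (if c k + p \<in> S then 1 else 0) * indicator Q p :: ennreal)"
      by (intro sum.cong) (auto simp: T_def indicator_def)
    also have "\<dots> = of_nat (card {k \<in> K. c k + p \<in> S}) * indicator Q p"
      using \<open>finite K\<close> by (simp add: sum_distrib_right[symmetric] sum.If_cases Int_def)
    also have "\<dots> \<le> of_nat (ex n (pattern_mat P)) * indicator Q p"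
      using sample[of p] by (intro mult_right_mono) auto
    finally show "(\<Sum>k\<in>K. indicator (T k) p) \<le> of_nat (ex n (pattern_mat P)) * (indicator Q p :: ennreal)" .
  qed
  also have "\<dots> = of_nat (ex n (pattern_mat P)) * ennreal (Lx * Ly)"
    using Q by (simp add: nn_integral_cmult_indicator)
  also have "\<dots> = ennreal (Lx * Ly * real (ex n (pattern_mat P)))"
    using Lx Ly by (simp add: ennreal_mult'' ennreal_of_nat_eq_real_of_nat mult.commute)
  finally have "measure lborel S \<le> Lx * Ly * real (ex n (pattern_mat P))"
    using Lx Ly unfolding measure_def by (intro enn2real_leI) auto
  then show ?thesis using S(1) by simp
qed

section \<open>Choice of the constants and the two-sided estimate\<close>

theorem theorem3p1:
  shows "\<exists>C1 C2 :: real set \<Rightarrow> real set \<Rightarrow> real.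
    \<forall>P :: (real \<times> real) set. finite P \<longrightarrow> P \<noteq> {} \<longrightarrow>
      0 < C1 (row_distances P) (col_distances P) \<and>
      0 < C2 (row_distances P) (col_distances P) \<and>
      (\<forall>\<^sub>F n :: nat in sequentially.
         C1 (row_distances P) (col_distances P) * real (ex n (pattern_mat P)) \<le> opx (real n) P \<and>
         opx (real n) P \<le> C2 (row_distances P) (col_distances P) * real (ex n (pattern_mat P)))"
proof (intro exI allI impI)
  fix P :: "(real \<times> real) set"
  assume P: "finite P" "P \<noteq> {}"
  let ?R = "insert 1 (row_distances P)" and ?C = "insert 1 (col_distances P)"
  \<comment> \<open>Products of extreme distances, seen as functions of the two distance sets alone.
    Inserting 1 bounds the minima above and the maxima below by 1, and keeps the sets nonempty when
    \<open>P\<close> has a single row or column.\<close>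
  let ?C1 = "\<lambda>R C :: real set. Min (insert 1 C) * Min (insert 1 R)"
  let ?C2 = "\<lambda>R C :: real set. Max (insert 1 C) * Max (insert 1 R)"
  have "row_distances P = (\<lambda>(y, y'). dist y y') ` {(y, y') \<in> snd ` P \<times> snd ` P. y \<noteq> y'}"
    "col_distances P = (\<lambda>(x, x'). dist x x') ` {(x, x') \<in> fst ` P \<times> fst ` P. x \<noteq> x'}"
    by (auto simp: row_distances_def col_distances_def image_iff)
  moreover have "finite {(y, y') \<in> snd ` P \<times> snd ` P. y \<noteq> y'}" "finite {(x, x') \<in> fst ` P \<times> fst ` P. x \<noteq> x'}"
    using P(1) by (auto intro: finite_subset[of _ "snd ` P \<times> snd ` P"] finite_subset[of _ "fst ` P \<times> fst ` P"])
  ultimately have fin: "finite ?R" "finite ?C" by auto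
  have pos: "0 < Min ?R" "0 < Min ?C"
    using fin by (auto simp: row_distances_def col_distances_def)
  have ge1: "Min ?R \<le> 1" "Min ?C \<le> 1" "1 \<le> Max ?R" "1 \<le> Max ?C"
    using fin by auto
  have y: "Min ?R \<le> y - y'" "y - y' \<le> Max ?R" if "y \<in> snd ` P" "y' \<in> snd ` P" "y' < y" for y y'
  proof -
    have "dist y y' \<in> ?R" using that less_imp_neq[OF that(3)] unfolding row_distances_def by fastforce
    then have "y - y' \<in> ?R" using that(3) by (simp add: dist_real_def)
    then show "Min ?R \<le> y - y'" "y - y' \<le> Max ?R" using fin by (auto intro: Min_le Max_ge simp del: Min_insert Max_insert)
  qed
  have x: "Min ?C \<le> x - x'" "x - x' \<le> Max ?C" if "x \<in> fst ` P" "x' \<in> fst ` P" "x' < x" for x x'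
  proof -
    have "dist x x' \<in> ?C" using that less_imp_neq[OF that(3)] unfolding col_distances_def by fastforce
    then have "x - x' \<in> ?C" using that(3) by (simp add: dist_real_def)
    then show "Min ?C \<le> x - x'" "x - x' \<le> Max ?C" using fin by (auto intro: Min_le Max_ge simp del: Min_insert Max_insert)
  qed
  show "0 < ?C1 (row_distances P) (col_distances P) \<and>
      0 < ?C2 (row_distances P) (col_distances P) \<and>
      (\<forall>\<^sub>F n :: nat in sequentially.
         ?C1 (row_distances P) (col_distances P) * real (ex n (pattern_mat P)) \<le> opx (real n) P \<and>
         opx (real n) P \<le> ?C2 (row_distances P) (col_distances P) * real (ex n (pattern_mat P)))"
  \<comment> \<open>Both estimates hold for every \<open>n\<close>, not only for large ones.\<close>
  proof (intro conjI always_eventually allI)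
    show "0 < Min ?C * Min ?R" using pos by simp
    show "0 < Max ?C * Max ?R" using ge1 by (intro mult_pos_pos) linarith+
    fix n :: nat
    let ?F = "{S. open S \<and> S \<subseteq> {0..real n} \<times> {0..real n} \<and> \<not> plane_contains S P}"
    have upper: "measure lebesgue S \<le> Max ?C * Max ?R * real (ex n (pattern_mat P))" if "S \<in> ?F" for S
      using measure_open_free_le[OF P(1) ge1(4) x(2) ge1(3) y(2)] that by blast
    \<comment> \<open>A point of \<open>P\<close> has no image in the empty set. So the supremum
      ranges over a nonempty family, and \<open>upper\<close> bounds it from above.\<close>
    have "{} \<in> ?F" using P(2) by (auto simp: plane_contains_def)
    then show "opx (real n) P \<le> Max ?C * Max ?R * real (ex n (pattern_mat P))"
      unfolding opx_def using upper by (intro cSUP_least) blast+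
    obtain A where A: "A \<in> carrier_mat n n" "zero_one_mat A" "\<not> mat_contains A (pattern_mat P)"
      and num: "num_ones A = ex n (pattern_mat P)"
      using ex_attained[OF P] .
    obtain S where S: "open S" "S \<subseteq> {0..real n} \<times> {0..real n}" "\<not> plane_contains S P"
      and meas: "measure lebesgue S = Min ?C * Min ?R * real (num_ones A)"
      by (rule open_free_set_from_mat[OF P(1) pos(2) ge1(2) x(1) pos(1) ge1(1) y(1) A])
    have "measure lebesgue S \<le> opx (real n) P"
      unfolding opx_def using S upper by (intro cSUP_upper bdd_aboveI2) blast+
    then show "Min ?C * Min ?R * real (ex n (pattern_mat P)) \<le> opx (real n) P"
      using meas num by simp
  qed
qed

end
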